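(* Any method $Y$ assigning a finite number to the sequence $(1,2,3,4,5,\dots)$ (as a proposed replacement for the sum $1+2+3+4+5+\cdots$) is (i) not totally regular, (ii) not regular, and (iii) contradictory.
   Context: A method $Y$ assigns values to real sequences $(a_0,a_1,a_2,\dots)$ in its domain, as a proposed replacement for the sum of the series $a_0+a_1+a_2+\cdots$; write $Y(\{a_n\})=s$ when the assigned value is $s$. Throughout, the following is assumed of every method $Y$. Well-posedness: the value assigned to a sequence is unique whenever the sequence belongs to the domain of $Y$. Domain: the sequences of terms of all series convergent in the usual sense belong to the domain of $Y$ (also when $Y$ is not regular). Axioms: (A) for any real $k$, $Y(\{a_n\})=s$ implies $Y(\{ka_n\})=ks$; (B) $Y(\{a_n\})=s$ and $Y(\{b_n\})=r$ imply $Y(\{a_n+b_n\})=s+r$; (C) $Y(\{a_0,a_1,a_2,\dots\})=s$ if and only if $Y(\{a_1,a_2,a_3,\dots\})=s-a_0$. Definitions: $Y$ is regular if the value it assigns to a series coincides with the standard sum whenever the series converges in the standard sense (limit of partial sums). $Y$ is totally regular if it is regular and series diverging to $\pm\infty$ in the standard sense (partial sums tending to $\pm\infty$) also diverge to $\pm\infty$ in $Y$. $Y$ is contradictory if incompatible statements of the form $r=Y(\{a_n\})=s$, for different real numbers $r$ and $s$, can be proved in this context (that is, from the assumptions on $Y$ above together with the hypothesis that $Y$ assigns a finite number to the given sequence). *)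

theory Defs
  imports Complex_Main "HOL-Library.Extended_Real"
begin

text \<open>
  A method is a relation: \<open>Y a v\<close> says that \<open>Y\<close> assigns the value \<open>v\<close> to the sequence of
  terms \<open>a\<close>. The values \<open>\<infinity>\<close> and \<open>-\<infinity>\<close> express divergence in \<open>Y\<close>. Uniqueness of the assigned value
  (well-posedness) is deliberately not built into the type: no single-valued \<open>Y\<close> that satisfies the
  axioms assigns a finite number to \<open>(1,2,3,\<dots>)\<close>, so statements about such \<open>Y\<close> would be vacuous.
  Well-posedness enters below as a rule of inference of the context in which \<open>contradictory\<close> is
  defined, and as part of regularity.
\<close>

type_synonym smethod = "(nat \<Rightarrow> real) \<Rightarrow> ereal \<Rightarrow> bool"

definition domain_assumption :: "smethod \<Rightarrow> bool" where
  "domain_assumption Y \<longleftrightarrow> (\<forall>a. summable a \<longrightarrow> (\<exists>v. Y a v))"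

definition axiom_A :: "smethod \<Rightarrow> bool" where
  "axiom_A Y \<longleftrightarrow> (\<forall>a s k. Y a (ereal s) \<longrightarrow> Y (\<lambda>n. k * a n) (ereal (k * s)))"

definition axiom_B :: "smethod \<Rightarrow> bool" where
  "axiom_B Y \<longleftrightarrow> (\<forall>a b s r. Y a (ereal s) \<longrightarrow> Y b (ereal r) \<longrightarrow> Y (\<lambda>n. a n + b n) (ereal (s + r)))"

definition axiom_C :: "smethod \<Rightarrow> bool" where
  "axiom_C Y \<longleftrightarrow> (\<forall>a s. Y a (ereal s) \<longleftrightarrow> Y (\<lambda>n. a (Suc n)) (ereal (s - a 0)))"

definition regular :: "smethod \<Rightarrow> bool" where
  "regular Y \<longleftrightarrow> (\<forall>a s. a sums s \<longrightarrow> (\<forall>v. Y a v \<longleftrightarrow> v = ereal s))"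

definition totally_regular :: "smethod \<Rightarrow> bool" where
  "totally_regular Y \<longleftrightarrow> regular Y \<and>
     (\<forall>a. filterlim (\<lambda>n. \<Sum>i<n. a i) at_top sequentially \<longrightarrow> (\<forall>v. Y a v \<longleftrightarrow> v = \<infinity>)) \<and>
     (\<forall>a. filterlim (\<lambda>n. \<Sum>i<n. a i) at_bot sequentially \<longrightarrow> (\<forall>v. Y a v \<longleftrightarrow> v = -\<infinity>))"

text \<open>
  Provability of statements about a method, in the context given by the domain assumption,
  the axioms (A), (B), (C), well-posedness, and the hypothesis that the method assigns the real
  number \<open>s\<close> to the sequence \<open>c\<close>. The values whose existence the domain assumption asserts are named
  by \<open>val\<close>. The method itself does not occur: only what is derivable from these assumptions counts.
\<close>

datatype statement =
    Assigned "nat \<Rightarrow> real" ereal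
  | Equal ereal ereal

inductive provable :: "(nat \<Rightarrow> real) \<Rightarrow> real \<Rightarrow> ((nat \<Rightarrow> real) \<Rightarrow> ereal) \<Rightarrow> statement \<Rightarrow> bool"
  for c :: "nat \<Rightarrow> real" and s :: real and val :: "(nat \<Rightarrow> real) \<Rightarrow> ereal"
where
  hypothesis: "provable c s val (Assigned c (ereal s))"
| in_domain: "summable a \<Longrightarrow> provable c s val (Assigned a (val a))"
| rule_A: "provable c s val (Assigned a (ereal x))
    \<Longrightarrow> provable c s val (Assigned (\<lambda>n. k * a n) (ereal (k * x)))"
| rule_B: "provable c s val (Assigned a (ereal x)) \<Longrightarrow> provable c s val (Assigned b (ereal y))
    \<Longrightarrow> provable c s val (Assigned (\<lambda>n. a n + b n) (ereal (x + y)))"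
| rule_C1: "provable c s val (Assigned a (ereal x))
    \<Longrightarrow> provable c s val (Assigned (\<lambda>n. a (Suc n)) (ereal (x - a 0)))"
| rule_C2: "provable c s val (Assigned (\<lambda>n. a (Suc n)) (ereal (x - a 0)))
    \<Longrightarrow> provable c s val (Assigned a (ereal x))"
| well_posed: "provable c s val (Assigned a v) \<Longrightarrow> provable c s val (Assigned a w)
    \<Longrightarrow> provable c s val (Equal v w)"
| substitution: "provable c s val (Assigned a v) \<Longrightarrow> provable c s val (Equal v w)
    \<Longrightarrow> provable c s val (Assigned a w)"

definition contradictory :: "smethod \<Rightarrow> (nat \<Rightarrow> real) \<Rightarrow> bool" where
  "contradictory Y c \<longleftrightarrow>
     (\<forall>s val. Y c (ereal s) \<longrightarrow> (\<forall>a. summable a \<longrightarrow> Y a (val a)) \<longrightarrow>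
        (\<exists>a r t. r \<noteq> t \<and> provable c s val (Assigned a (ereal r))
                      \<and> provable c s val (Assigned a (ereal t))))"

end

theory Submission
  imports Defs
begin

text \<open>Subtracting 1+2+3+... termwise from its shift 2+3+4+... leaves 1+1+1+..., which thus
  gets the value (s-1)-s = -1. But the constant sequence is its own shift, so (C) also gives it -1-1
  = -2. Regularity fails because the difference of the two values lands on the zero series. Since
  \<open>ones_two_values\<close> rests on (A)-(C) alone and never on uniqueness, it applies both to
  \<open>Y\<close> and, through \<open>provable_axioms\<close>, to derivability.\<close>

lemma ones_two_values:
  fixes Y :: smethod
  assumes A: "axiom_A Y" and B: "axiom_B Y" and C: "axiom_C Y"
    and s: "Y (\<lambda>n. real n + 1) (ereal s)"
  shows "Y (\<lambda>n. 1) (ereal (-1))" and "Y (\<lambda>n. 1) (ereal (-2))"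
proof -
  have shift: "Y (\<lambda>n. a (Suc n)) (ereal (x - a 0))" if "Y a (ereal x)" for a x
    using C that by (simp add: axiom_C_def)
  have "Y (\<lambda>n. -1 * (real n + 1)) (ereal (-1 * s))"
    using A s unfolding axiom_A_def by blast
  then have "Y (\<lambda>n. (real (Suc n) + 1) + -1 * (real n + 1)) (ereal ((s - (real 0 + 1)) + -1 * s))"
    using B shift[OF s] unfolding axiom_B_def by blast
  then show minus_one: "Y (\<lambda>n. 1) (ereal (-1))"
    by simp
  \<comment> \<open>Dropping the leading 1 changes the value but not the sequence.\<close>
  show "Y (\<lambda>n. 1) (ereal (-2))"
    using shift[OF minus_one] by simp
qed

text \<open>Derivability of assignments, read as a relation between sequences and values, is itself
  a method obeying the axioms; facts about all such methods thereby become derivations.\<close>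

lemma provable_axioms:
  shows "axiom_A (\<lambda>a v. provable c s val (Assigned a v))"
    and "axiom_B (\<lambda>a v. provable c s val (Assigned a v))"
    and "axiom_C (\<lambda>a v. provable c s val (Assigned a v))"
  unfolding axiom_A_def axiom_B_def axiom_C_def
  by (blast intro: rule_A rule_B rule_C1 rule_C2)+

theorem theorem2:
  fixes Y :: smethod
  assumes "domain_assumption Y" and "axiom_A Y" and "axiom_B Y" and "axiom_C Y"
    and "\<exists>s::real. Y (\<lambda>n. real n + 1) (ereal s)"
  shows "\<not> totally_regular Y \<and> \<not> regular Y \<and> contradictory Y (\<lambda>n. real n + 1)"
proof -
  obtain s where s: "Y (\<lambda>n. real n + 1) (ereal s)"
    using assms(5) by blast
  note ones = ones_two_values[OF assms(2-4) s]
  \<comment> \<open>Value -1 minus value -2 of the same sequence: the zero series gets 1 instead of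
    its sum 0.\<close>
  have "Y (\<lambda>n. -1 * 1) (ereal (-1 * -2))"
    using assms(2) ones(2) unfolding axiom_A_def by blast
  then have "Y (\<lambda>n. 1 + -1 * 1) (ereal (-1 + -1 * -2))"
    using assms(3) ones(1) unfolding axiom_B_def by blast
  then have zero: "Y (\<lambda>n. 0) (ereal 1)"
    by simp
  have not_regular: "\<not> regular Y"
  proof
    assume "regular Y"
    then have "ereal 1 = ereal 0"
      using zero sums_zero unfolding regular_def by blast
    then show False by simp
  qed
  moreover have "contradictory Y (\<lambda>n. real n + 1)"
    unfolding contradictory_def
  proof (intro allI impI)
    fix s val
    \<comment> \<open>Here the method is derivability itself, so both -1 and -2 are provable values
      of 1+1+1+....\<close>
    note ones_two_values[OF provable_axioms provable.hypothesis, of s val]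
    moreover have "(-1::real) \<noteq> -2" by simp
    ultimately show "\<exists>a r t. r \<noteq> t \<and> provable (\<lambda>n. real n + 1) s val (Assigned a (ereal r))
        \<and> provable (\<lambda>n. real n + 1) s val (Assigned a (ereal t))"
      by blast
  qed
  ultimately show ?thesis
    unfolding totally_regular_def by blast
qed

end
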